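(* Let $\Omega\subset\mathbb{C}$, $p,q\in\mathcal{H}(\Omega)$, and $k_0(a,a')=-q(a')/p(a)$ be as in the context. Suppose that there is a real constant $\tau>0$ such that $k_0(a,a)-\tau/a$ is bounded on a neighborhood of $0$ in $\Omega$, and such that for each $\sigma>\tau$ there is a neighborhood of $(0,0)$ in $\Omega^2$ on which $|k_0(a,a')|<\sigma/|a|$. For a base point $b\in\Omega$, let $$f_0(a)=\frac{1}{p(a)}\exp\left(-\int_b^a\frac{q(s)}{p(s)}\,ds\right),\qquad a\in\Omega.$$ (1) On a small enough neighborhood of $0$ in $\Omega$, there is a constant $C$ such that $|f_0(a)|\le C|a|^{\tau-1}$. (2) Suppose in addition that there are a constant $\lambda_\Delta\in\mathbb{R}$ and a constant $M$ such that $$|k_0(a,a')|\le \frac{M}{|a|}\,e^{\lambda_\Delta|a-a'|}\quad\text{for all }a,a'\in\Omega.$$ Then $f_0\in\mathcal{H}L^\infty_{\tau-1,\bullet}(\Omega)$.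
   Context: $\Omega\subset\mathbb{C}$ is a simply connected open set with $0\notin\Omega$ and $0\in\overline{\Omega}$, star-shaped around $0$: for every $a\in\Omega$ the segment $\{ta: 0<t\le 1\}$ lies in $\Omega$. $\mathcal{H}(\Omega)$ is the space of holomorphic functions on $\Omega$. The functions $p,q\in\mathcal{H}(\Omega)$ are such that $k_0(a,a')=-q(a')/p(a)$ is holomorphic on $\Omega^2$ (so $p$ has no zeros in $\Omega$ when $q\not\equiv0$). Integrals $\int_b^a$ with $b\in\Omega$ are taken along any path in $\Omega$. A neighborhood of $0$ in $\Omega$ means $U\cap\Omega$ with $U\subset\mathbb{C}$ an open neighborhood of $0$, and similarly a neighborhood of $(0,0)$ in $\Omega^2$ means $U\cap\Omega^2$ with $U\subset\mathbb{C}^2$ an open neighborhood of $(0,0)$. For $\sigma,\Lambda\in\mathbb{R}$, $\mathcal{H}L^\infty_{\sigma,\Lambda}(\Omega)$ is the space of $f\in\mathcal{H}(\Omega)$ with $\|f\|_{\sigma,\Lambda}:=\sup_{a\in\Omega}|a|^{-\sigma}e^{-\Lambda|a|}|f(a)|<\infty$, and $\mathcal{H}L^\infty_{\sigma,\bullet}(\Omega)=\bigcup_{\Lambda\in\mathbb{R}}\mathcal{H}L^\infty_{\sigma,\Lambda}(\Omega)$. *)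

theory Defs
  imports "HOL-Complex_Analysis.Complex_Analysis" "HOL-Library.Extended_Nonnegative_Real"
begin

text \<open>Stars with the vertex \<^term>\<open>0\<close> left out; this is not \<^const>\<open>starlike\<close>, for which the
  centre belongs to the set.\<close>

definition star_shaped_0 :: "complex set \<Rightarrow> bool" where
  "star_shaped_0 \<Omega> \<longleftrightarrow> (\<forall>a\<in>\<Omega>. \<forall>t::real. 0 < t \<and> t \<le> 1 \<longrightarrow> of_real t * a \<in> \<Omega>)"

text \<open>Holomorphy in two variables: Frechet differentiability with a complex-linear derivative.\<close>

definition holomorphic2_on :: "(complex \<times> complex \<Rightarrow> complex) \<Rightarrow> (complex \<times> complex) set \<Rightarrow> bool" where
  "holomorphic2_on k S \<longleftrightarrow>
     (\<forall>z\<in>S. \<exists>\<alpha> \<beta>. (k has_derivative (\<lambda>(h, h'). \<alpha> * h + \<beta> * h')) (at z within S))"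

text \<open>Where \<^term>\<open>p a = 0\<close> the quotient below has the value \<^term>\<open>0\<close>. Such a value cannot make it
  holomorphic on \<^term>\<open>\<Omega> \<times> \<Omega>\<close> across a zero of \<^term>\<open>p\<close>: if \<^term>\<open>q\<close> does not vanish
  identically, then it is unbounded near an isolated zero of \<^term>\<open>p\<close>.\<close>

definition k0 :: "(complex \<Rightarrow> complex) \<Rightarrow> (complex \<Rightarrow> complex) \<Rightarrow> complex \<times> complex \<Rightarrow> complex" where
  "k0 p q = (\<lambda>(a, a'). - q a' / p a)"

text \<open>The integral of \<^term>\<open>g\<close> from \<^term>\<open>b\<close> to \<^term>\<open>a\<close> along a path in \<^term>\<open>\<Omega>\<close>. On a simply connected
  domain the choice of the path is immaterial, see \<open>integral_along_eq\<close> below.\<close>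

definition integral_along :: "complex set \<Rightarrow> complex \<Rightarrow> complex \<Rightarrow> (complex \<Rightarrow> complex) \<Rightarrow> complex" where
  "integral_along \<Omega> b a g =
     contour_integral
       (SOME \<gamma>. valid_path \<gamma> \<and> path_image \<gamma> \<subseteq> \<Omega> \<and> pathstart \<gamma> = b \<and> pathfinish \<gamma> = a) g"

lemma integral_along_eq:
  assumes "open \<Omega>" "simply_connected \<Omega>" "g holomorphic_on \<Omega>"
    and \<gamma>: "valid_path \<gamma>" "path_image \<gamma> \<subseteq> \<Omega>" "pathstart \<gamma> = b" "pathfinish \<gamma> = a"
  shows "integral_along \<Omega> b a g = contour_integral \<gamma> g"
proof -
  define \<delta> where "\<delta> = (SOME \<gamma>. valid_path \<gamma> \<and> path_image \<gamma> \<subseteq> \<Omega> \<and> pathstart \<gamma> = b \<and> pathfinish \<gamma> = a)"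
  have \<delta>: "valid_path \<delta> \<and> path_image \<delta> \<subseteq> \<Omega> \<and> pathstart \<delta> = b \<and> pathfinish \<delta> = a"
    unfolding \<delta>_def by (rule someI[of _ \<gamma>]) (use \<gamma> in auto)
  have "homotopic_paths \<Omega> \<delta> \<gamma>"
    using assms(2) \<gamma> \<delta> by (simp add: simply_connected_eq_homotopic_paths valid_path_imp_path)
  then have "contour_integral \<delta> g = contour_integral \<gamma> g"
    using Cauchy_theorem_homotopic_paths[OF _ assms(1,3)] \<gamma> \<delta> by blast
  then show ?thesis
    unfolding integral_along_def \<delta>_def .
qed

definition f0 :: "complex set \<Rightarrow> (complex \<Rightarrow> complex) \<Rightarrow> (complex \<Rightarrow> complex) \<Rightarrow> complex \<Rightarrow> complex \<Rightarrow> complex" where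
  "f0 \<Omega> p q b a = 1 / p a * exp (- integral_along \<Omega> b a (\<lambda>s. q s / p s))"

definition HL_norm :: "real \<Rightarrow> real \<Rightarrow> complex set \<Rightarrow> (complex \<Rightarrow> complex) \<Rightarrow> ennreal" where
  "HL_norm \<sigma> \<Lambda> \<Omega> f = (SUP a\<in>\<Omega>. ennreal (cmod a powr (- \<sigma>) * exp (- \<Lambda> * cmod a) * cmod (f a)))"

definition HL :: "real \<Rightarrow> real \<Rightarrow> complex set \<Rightarrow> (complex \<Rightarrow> complex) set" where
  "HL \<sigma> \<Lambda> \<Omega> = {f. f holomorphic_on \<Omega> \<and> HL_norm \<sigma> \<Lambda> \<Omega> f < \<infinity>}"

definition HL_bullet :: "real \<Rightarrow> complex set \<Rightarrow> (complex \<Rightarrow> complex) set" where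
  "HL_bullet \<sigma> \<Omega> = (\<Union>\<Lambda>. HL \<sigma> \<Lambda> \<Omega>)"

end

theory Submission
  imports Defs
begin

text \<open>Write \<open>k\<^sub>0(s,s) = \<tau>/s + g(s)\<close>. Integrating and exponentiating turns \<open>\<tau>/s\<close> into the factor
  \<open>|a|\<^sup>\<tau>\<close>, the bound of \<open>k\<^sub>0\<close> at a fixed \<open>a'\<close> with \<open>q(a') \<noteq> 0\<close> gives the factor \<open>|a|\<^sup>-\<^sup>1\<close> through \<open>1/p\<close>,
  and it remains to control a primitive of \<open>g\<close>. Two points of \<open>\<Omega>\<close> are joined by going along the ray of
  the first one towards \<open>0\<close>, then along a very small scaled copy \<open>t\<gamma>\<close> of a path \<open>\<gamma>\<close> between them, and
  then along the ray of the second one away from \<open>0\<close>; letting \<open>t \<rightarrow> 0\<close>, a bound \<open>B\<close> of \<open>g\<close> makes the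
  primitive vary by at most \<open>B(|a| + |a'|)\<close>. For (1) such a bound is available near \<open>0\<close>; for (2) it is
  available on all of \<open>\<Omega>\<close>, because the diagonal values satisfy \<open>|k\<^sub>0(s,s)| \<le> M/|s|\<close>.\<close>

section \<open>Zeros of the denominator and continuity of the kernel\<close>

text \<open>Since division by zero gives 0, the product \<open>p x * (c / p x)\<close> takes only
  the values 0 and \<open>c\<close>. Being continuous on a connected set it is constant, and at
  \<open>x0\<close> it equals \<open>c\<close>.\<close>

lemma nonzero_if_continuous_divide:
  fixes p :: "'a::topological_space \<Rightarrow> 'b::real_normed_field"
  assumes "connected S" "continuous_on S p" "continuous_on S (\<lambda>x. c / p x)" "c \<noteq> 0"
    and "x0 \<in> S" "p x0 \<noteq> 0" "x \<in> S"
  shows "p x \<noteq> 0"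
proof -
  have "(\<lambda>x. p x * (c / p x)) constant_on S"
  proof (rule continuous_finite_range_constant[OF assms(1)])
    show "continuous_on S (\<lambda>x. p x * (c / p x))"
      by (intro continuous_intros assms)
    have "(\<lambda>x. p x * (c / p x)) ` S \<subseteq> {0, c}" by auto
    then show "finite ((\<lambda>x. p x * (c / p x)) ` S)"
      using finite_subset by blast
  qed
  then have "p x * (c / p x) = p x0 * (c / p x0)"
    using assms unfolding constant_on_def by metis
  then show ?thesis using assms by auto
qed

lemma holomorphic2_on_imp_continuous_on: "holomorphic2_on k S \<Longrightarrow> continuous_on S k"
  unfolding holomorphic2_on_def continuous_on_eq_continuous_within
  using has_derivative_continuous by blast

section \<open>Primitives on star-shaped domains\<close>

text \<open>By substitution the difference is the integral of \<open>g (t * z) * t\<close> along the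
  unscaled path, so \<open>L\<close> depends on the path but not on \<open>t\<close>.\<close>

lemma primitive_diff_scaled_path:
  assumes "open \<Omega>" and star: "star_shaped_0 \<Omega>"
    and G: "\<And>s. s \<in> \<Omega> \<Longrightarrow> (G has_field_derivative g s) (at s)"
    and bnd: "\<And>s. s \<in> \<Omega> \<Longrightarrow> cmod s < \<rho> \<Longrightarrow> cmod (g s) \<le> B"
    and \<gamma>: "valid_path \<gamma>" "path_image \<gamma> \<subseteq> \<Omega>"
    and "\<rho> > 0"
  obtains L t0 where "0 < L" "0 < t0" "t0 \<le> 1"
    "\<And>t. 0 < t \<Longrightarrow> t \<le> t0 \<Longrightarrow>
      cmod (G (of_real t * pathfinish \<gamma>) - G (of_real t * pathstart \<gamma>)) \<le> L * (t * B)"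
proof -
  have "bounded (path_image \<gamma>)"
    using \<gamma>(1) by (simp add: bounded_path_image valid_path_imp_path)
  then obtain R where R: "R > 0" "path_image \<gamma> \<subseteq> ball 0 R"
    by (meson bounded_subset_ballD)
  \<comment> \<open>The bound on the contour integral refers to an open set around the path image.
    Keeping this set bounded lets a scaling move all of it close to 0.\<close>
  define S where "S = \<Omega> \<inter> ball 0 R"
  have S: "open S" "path_image \<gamma> \<subseteq> S"
    using assms R by (auto simp: S_def)
  obtain L where L: "0 < L" "\<And>f B. f holomorphic_on S \<Longrightarrow> (\<And>z. z \<in> S \<Longrightarrow> cmod (f z) \<le> B) \<Longrightarrow>
      cmod (contour_integral \<gamma> f) \<le> L * B"
    using contour_integral_bound_exists[OF S(1) \<gamma>(1) S(2)] by blast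
  have g: "g holomorphic_on \<Omega>"
    using G \<open>open \<Omega>\<close> by (metis DERIV_deriv_iff_field_differentiable DERIV_imp_deriv
        field_differentiable_def holomorphic_cong holomorphic_deriv holomorphic_on_open)
  show ?thesis
  proof (rule that[OF L(1)])
    \<comment> \<open>With \<open>t \<le> 1\<close> the scaled points stay in the star, and with
      \<open>t \<le> \<rho> / R\<close> they lie in the ball of radius
      \<open>\<rho>\<close>.\<close>
    show "0 < min 1 (\<rho> / R)" "min 1 (\<rho> / R) \<le> 1" using R \<open>\<rho> > 0\<close> by auto
    fix t :: real assume t: "0 < t" "t \<le> min 1 (\<rho> / R)"
    have in\<Omega>: "of_real t * z \<in> \<Omega>" if "z \<in> S" for z
      using star t that by (auto simp: star_shaped_0_def S_def)
    have "((\<lambda>z. g (of_real t * z) * of_real t) has_contour_integral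
        G (of_real t * pathfinish \<gamma>) - G (of_real t * pathstart \<gamma>)) \<gamma>"
    proof (rule contour_integral_primitive[OF _ \<gamma>(1) S(2)])
      fix z assume "z \<in> S"
      then show "((\<lambda>z. G (of_real t * z)) has_field_derivative g (of_real t * z) * of_real t) (at z within S)"
        by (intro DERIV_chain2[where g = "\<lambda>z. of_real t * z", OF G] in\<Omega>)
          (auto intro!: derivative_eq_intros)
    qed
    then have "G (of_real t * pathfinish \<gamma>) - G (of_real t * pathstart \<gamma>)
        = contour_integral \<gamma> (\<lambda>z. g (of_real t * z) * of_real t)"
      by (simp add: contour_integral_unique)
    also have "cmod \<dots> \<le> L * (t * B)"
    proof (rule L(2))
      show "(\<lambda>z. g (of_real t * z) * of_real t) holomorphic_on S"
        using in\<Omega> by (intro holomorphic_intros holomorphic_on_compose_gen[OF _ g, unfolded o_def]) auto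
      fix z assume z: "z \<in> S"
      then have "t * cmod z < t * R" using t by (auto simp: S_def)
      also have "\<dots> \<le> \<rho>" using t R by (simp add: field_simps)
      finally have "cmod (of_real t * z) < \<rho>" using t by (simp add: norm_mult)
      from bnd[OF in\<Omega>[OF z] this] show "cmod (g (of_real t * z) * of_real t) \<le> t * B"
        using t by (simp add: norm_mult mult.commute)
    qed
    finally show "cmod (G (of_real t * pathfinish \<gamma>) - G (of_real t * pathstart \<gamma>)) \<le> L * (t * B)" .
  qed
qed

text \<open>The segment from \<open>t * a\<close> to \<open>a\<close> stays in the star and in the
  ball of radius \<open>\<rho>\<close>, and its length is at most \<open>cmod a\<close>. The mean
  value inequality is therefore uniform in \<open>t\<close>.\<close>

lemma primitive_diff_ray:
  assumes star: "star_shaped_0 \<Omega>"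
    and G: "\<And>s. s \<in> \<Omega> \<Longrightarrow> (G has_field_derivative g s) (at s)"
    and bnd: "\<And>s. s \<in> \<Omega> \<Longrightarrow> cmod s < \<rho> \<Longrightarrow> cmod (g s) \<le> B"
    and a: "a \<in> \<Omega>" "cmod a < \<rho>" and t: "0 < t" "t \<le> 1"
  shows "cmod (G a - G (of_real t * a)) \<le> B * cmod a"
proof -
  have seg: "x \<in> \<Omega> \<and> cmod x < \<rho>" if x: "x \<in> closed_segment (of_real t * a) a" for x
  proof -
    obtain u where u: "0 \<le> u" "u \<le> 1" "x = (1 - u) *\<^sub>R (of_real t * a) + u *\<^sub>R a"
      using x by (auto simp: in_segment)
    define v where "v = (1 - u) * t + u"
    have x_eq: "x = of_real v * a"
      by (simp add: u v_def scaleR_conv_of_real algebra_simps)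
    have "(1 - u) * t \<le> (1 - u) * 1" using u t by (intro mult_left_mono) auto
    then have "v \<le> 1" by (simp add: v_def)
    \<comment> \<open>Strictness matters here, since the star leaves out its vertex.\<close>
    moreover have "v > 0"
      using u t by (cases "u = 0") (auto simp: v_def intro: add_nonneg_pos)
    ultimately have "x \<in> \<Omega>" "cmod x \<le> 1 * cmod a"
      using star a unfolding star_shaped_0_def x_eq by (auto simp: norm_mult intro: mult_left_le_one_le)
    then show ?thesis using a by auto
  qed
  have B: "0 \<le> B" using bnd[OF a] norm_ge_zero order_trans by blast
  have "cmod (G a - G (of_real t * a)) \<le> B * cmod (a - of_real t * a)"
    by (rule field_differentiable_bound[where S = "closed_segment (of_real t * a) a" and f' = g])
      (use seg G bnd in \<open>auto intro: has_field_derivative_at_within\<close>)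
  also have "a - of_real t * a = of_real (1 - t) * a" by (simp add: algebra_simps)
  also have "cmod \<dots> \<le> 1 * cmod a"
    unfolding norm_mult norm_of_real using t by (intro mult_right_mono) auto
  finally show ?thesis using B by (simp add: mult_left_mono)
qed

text \<open>The path joining the two points may be long and may leave the ball of radius
  \<open>\<rho>\<close>: only its scaled copies enter, and their contribution tends to 0.\<close>

lemma star_primitive_diff_le:
  assumes "open \<Omega>" "connected \<Omega>" and star: "star_shaped_0 \<Omega>"
    and G: "\<And>s. s \<in> \<Omega> \<Longrightarrow> (G has_field_derivative g s) (at s)"
    and bnd: "\<And>s. s \<in> \<Omega> \<Longrightarrow> cmod s < \<rho> \<Longrightarrow> cmod (g s) \<le> B"
    and a: "a \<in> \<Omega>" "cmod a < \<rho>" and a': "a' \<in> \<Omega>" "cmod a' < \<rho>"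
  shows "cmod (G a - G a') \<le> B * (cmod a + cmod a')"
proof (rule field_le_epsilon)
  fix e :: real assume e: "e > 0"
  have B: "0 \<le> B" using bnd[OF a] norm_ge_zero order_trans by blast
  have \<rho>: "\<rho> > 0" using a norm_ge_zero le_less_trans by blast
  obtain \<gamma> where "polynomial_function \<gamma>" "path_image \<gamma> \<subseteq> \<Omega>" "pathstart \<gamma> = a'" "pathfinish \<gamma> = a"
    using connected_open_polynomial_connected[OF assms(1,2)] a a' by metis
  then obtain L t0 where L: "0 < L" "0 < t0" "t0 \<le> 1"
    "\<And>t. 0 < t \<Longrightarrow> t \<le> t0 \<Longrightarrow> cmod (G (of_real t * a) - G (of_real t * a')) \<le> L * (t * B)"
    using primitive_diff_scaled_path[OF assms(1) star G bnd _ _ \<rho>, of \<gamma>]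
    by (metis valid_path_polynomial_function)
  \<comment> \<open>This makes the middle contribution \<open>L * (t * B)\<close> at most
    \<open>e\<close>; the summand 1 keeps the denominator positive when
    \<open>B = 0\<close>.\<close>
  define t where "t = min t0 (e / (L * B + 1))"
  have LB: "L * B + 1 > 0" using L B by (simp add: add_nonneg_pos)
  have t: "0 < t" "t \<le> t0" "t \<le> 1" using L e LB by (auto simp: t_def)
  have "t * (L * B + 1) \<le> e"
    using LB by (simp add: t_def min_le_iff_disj pos_le_divide_eq[symmetric])
  then have "L * (t * B) \<le> e" using t by (simp add: algebra_simps)
  moreover note L(4)[OF t(1,2)] primitive_diff_ray[OF star G bnd a t(1,3)]
    primitive_diff_ray[OF star G bnd a' t(1,3)]
  moreover have "cmod (G a - G a') \<le> cmod (G a - G (of_real t * a))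
      + cmod (G (of_real t * a) - G (of_real t * a')) + cmod (G a' - G (of_real t * a'))"
    by norm
  ultimately show "cmod (G a - G a') \<le> B * (cmod a + cmod a') + e"
    by (simp add: algebra_simps)
qed

section \<open>Integrals and logarithms on simply connected domains\<close>

lemma integral_along_primitive:
  assumes "open \<Omega>" "simply_connected \<Omega>" "g holomorphic_on \<Omega>"
    and G: "\<And>s. s \<in> \<Omega> \<Longrightarrow> (G has_field_derivative g s) (at s)"
    and "a \<in> \<Omega>" "b \<in> \<Omega>"
  shows "integral_along \<Omega> b a g = G a - G b"
proof -
  obtain \<gamma> where \<gamma>: "polynomial_function \<gamma>" "path_image \<gamma> \<subseteq> \<Omega>" "pathstart \<gamma> = b" "pathfinish \<gamma> = a"
    using connected_open_polynomial_connected assms simply_connected_imp_connected by metis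
  have "(g has_contour_integral (G (pathfinish \<gamma>) - G (pathstart \<gamma>))) \<gamma>"
    using \<gamma> G by (intro contour_integral_primitive[where S = \<Omega>])
      (auto intro: has_field_derivative_at_within valid_path_polynomial_function)
  moreover have "integral_along \<Omega> b a g = contour_integral \<gamma> g"
    using \<gamma> by (intro integral_along_eq assms) (auto intro: valid_path_polynomial_function)
  ultimately show ?thesis
    using \<gamma> by (simp add: contour_integral_unique)
qed

lemma simply_connected_primitive:
  assumes "open S" "simply_connected S" "f holomorphic_on S"
  obtains F where "\<And>z. z \<in> S \<Longrightarrow> (F has_field_derivative f z) (at z)"
  using assms simply_connected_eq_global_primitive by metis

text \<open>Differentiating \<open>exp (L z) = z\<close> gives \<open>z * deriv L z = 1\<close>. The
  principal branch does not serve, as \<open>S\<close> may cross the negative real axis.\<close>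

lemma simply_connected_logarithm:
  fixes S :: "complex set"
  assumes "open S" "simply_connected S" "0 \<notin> S"
  obtains L where "\<And>z. z \<in> S \<Longrightarrow> exp (L z) = z"
    "\<And>z. z \<in> S \<Longrightarrow> (L has_field_derivative 1 / z) (at z)"
proof -
  obtain L where L: "L holomorphic_on S" "\<And>z. z \<in> S \<Longrightarrow> exp (L z) = z"
    using assms simply_connected_eq_holomorphic_log[OF assms(1)]
    by (metis holomorphic_on_ident)
  have "(L has_field_derivative 1 / z) (at z)" if z: "z \<in> S" for z
  proof -
    have D: "(L has_field_derivative deriv L z) (at z)"
      using L(1) assms(1) z by (rule holomorphic_derivI)
    have "((\<lambda>z. exp (L z)) has_field_derivative exp (L z) * deriv L z) (at z)"
      using D by (auto intro!: derivative_eq_intros)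
    then have "((\<lambda>z. z) has_field_derivative exp (L z) * deriv L z) (at z)"
      by (rule has_field_derivative_transform_within_open[OF _ assms(1) z L(2)])
    then have "z * deriv L z = 1"
      using L(2)[OF z] DERIV_unique[OF _ DERIV_ident] by metis
    then show ?thesis using D z assms(3) by (metis nonzero_mult_div_cancel_left mult_zero_left zero_neq_one)
  qed
  with L that show ?thesis by blast
qed

section \<open>The modulus of \<open>f0\<close>\<close>

text \<open>With \<open>\<Phi>\<close> a primitive of \<open>q / p\<close> and \<open>L\<close> a
  logarithm, \<open>G = - \<Phi> - \<tau> * L\<close> is a primitive of the regular part of the
  diagonal kernel. Only the real part \<open>ln (cmod s)\<close> of \<open>L s\<close> enters the
  modulus, so the branch does not affect the power of \<open>cmod a / cmod b\<close>.\<close>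

lemma f0_exp_primitive:
  assumes "open \<Omega>" "simply_connected \<Omega>" "0 \<notin> \<Omega>"
    and "p holomorphic_on \<Omega>" "q holomorphic_on \<Omega>" and p: "\<And>a. a \<in> \<Omega> \<Longrightarrow> p a \<noteq> 0"
    and b: "b \<in> \<Omega>"
  obtains G where "f0 \<Omega> p q b holomorphic_on \<Omega>"
    "\<And>s. s \<in> \<Omega> \<Longrightarrow> (G has_field_derivative (k0 p q (s, s) - of_real \<tau> / s)) (at s)"
    "\<And>a. a \<in> \<Omega> \<Longrightarrow>
      cmod (f0 \<Omega> p q b a) = (cmod a / cmod b) powr \<tau> * cmod (exp (G a - G b)) / cmod (p a)"
proof -
  have qp: "(\<lambda>s. q s / p s) holomorphic_on \<Omega>"
    using assms by (intro holomorphic_intros) auto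
  obtain \<Phi> where \<Phi>: "\<And>s. s \<in> \<Omega> \<Longrightarrow> (\<Phi> has_field_derivative q s / p s) (at s)"
    using simply_connected_primitive[OF assms(1,2) qp] by blast
  obtain L where L: "\<And>s. s \<in> \<Omega> \<Longrightarrow> exp (L s) = s"
    "\<And>s. s \<in> \<Omega> \<Longrightarrow> (L has_field_derivative 1 / s) (at s)"
    using simply_connected_logarithm[OF assms(1-3)] by blast
  define G where "G s = - \<Phi> s - of_real \<tau> * L s" for s
  have f0: "f0 \<Omega> p q b a = 1 / p a * exp (- (\<Phi> a - \<Phi> b))" if "a \<in> \<Omega>" for a
    unfolding f0_def using integral_along_primitive[OF assms(1,2) qp \<Phi> that b] by simp
  show ?thesis
  proof (rule that[of G])
    have "\<Phi> holomorphic_on \<Omega>"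
      using \<Phi> assms(1) holomorphic_on_open by blast
    then have "(\<lambda>a. 1 / p a * exp (- (\<Phi> a - \<Phi> b))) holomorphic_on \<Omega>"
      using assms by (intro holomorphic_intros) auto
    then show "f0 \<Omega> p q b holomorphic_on \<Omega>"
      using f0 by (simp cong: holomorphic_cong)
    show "(G has_field_derivative (k0 p q (s, s) - of_real \<tau> / s)) (at s)" if "s \<in> \<Omega>" for s
      unfolding G_def k0_def using \<Phi>[OF that] L(2)[OF that] by (auto intro!: derivative_eq_intros)
    fix a assume a: "a \<in> \<Omega>"
    have Re_L: "Re (L s) = ln (cmod s)" if "s \<in> \<Omega>" for s
      using L(1)[OF that] by (metis ln_exp norm_exp_eq_Re)
    have "a \<noteq> 0" "b \<noteq> 0" using a b assms(3) by auto
    then have "(cmod a / cmod b) powr \<tau> = exp (\<tau> * (Re (L a) - Re (L b)))"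
      using a b by (simp add: powr_def ln_div Re_L)
    then have "(cmod a / cmod b) powr \<tau> * cmod (exp (G a - G b)) = cmod (exp (- (\<Phi> a - \<Phi> b)))"
      by (simp add: norm_exp_eq_Re G_def flip: exp_add) (simp add: algebra_simps)
    then show "cmod (f0 \<Omega> p q b a) = (cmod a / cmod b) powr \<tau> * cmod (exp (G a - G b)) / cmod (p a)"
      by (simp add: f0[OF a] norm_mult norm_divide)
  qed
qed

text \<open>Shared last step of the local and the global estimate. Both \<open>E\<close> and
  \<open>K\<close> may depend on \<open>a\<close>, which the global estimate uses.\<close>

lemma f0_norm_le:
  assumes f0: "cmod (f0 \<Omega> p q b a) = (cmod a / cmod b) powr \<tau> * cmod (exp (G a - G b)) / cmod (p a)"
    and nz: "a \<noteq> 0" "b \<noteq> 0"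
    and G: "cmod (G a - G b) \<le> E" and p: "1 / cmod (p a) \<le> K / cmod a"
  shows "cmod (f0 \<Omega> p q b a) \<le> exp E * K / cmod b powr \<tau> * cmod a powr (\<tau> - 1)"
proof -
  have "cmod (exp (G a - G b)) \<le> exp E"
    using G norm_exp order_trans exp_le_cancel_iff by metis
  then have "cmod (f0 \<Omega> p q b a) \<le> (cmod a / cmod b) powr \<tau> * exp E * (K / cmod a)"
    unfolding f0 divide_inverse[of _ "cmod (p a)"] using p
    by (intro mult_mono mult_left_mono) (auto simp: inverse_eq_divide)
  also have "\<dots> = exp E * K / cmod b powr \<tau> * cmod a powr (\<tau> - 1)"
    using nz by (simp add: powr_divide powr_diff)
  finally show ?thesis .
qed

lemma in_HL_bullet_if_bound:
  assumes "f holomorphic_on \<Omega>" "0 \<notin> \<Omega>"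
    and bnd: "\<And>a. a \<in> \<Omega> \<Longrightarrow> cmod (f a) \<le> C * exp (\<Lambda> * cmod a) * cmod a powr \<sigma>"
  shows "f \<in> HL_bullet \<sigma> \<Omega>"
proof -
  have "HL_norm \<sigma> \<Lambda> \<Omega> f \<le> ennreal C"
    unfolding HL_norm_def
  proof (intro SUP_least ennreal_leI)
    fix a assume a: "a \<in> \<Omega>"
    then have "a \<noteq> 0" using assms by auto
    have "cmod a powr - \<sigma> * exp (- \<Lambda> * cmod a) * cmod (f a)
        \<le> cmod a powr - \<sigma> * exp (- \<Lambda> * cmod a) * (C * exp (\<Lambda> * cmod a) * cmod a powr \<sigma>)"
      by (intro mult_left_mono bnd a) auto
    also have "\<dots> = C" using \<open>a \<noteq> 0\<close> by (simp add: powr_minus exp_minus field_simps)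
    finally show "cmod a powr - \<sigma> * exp (- \<Lambda> * cmod a) * cmod (f a) \<le> C" .
  qed
  then have "HL_norm \<sigma> \<Lambda> \<Omega> f < \<infinity>"
    using ennreal_less_top le_less_trans by (metis infinity_ennreal_def)
  then show ?thesis using assms(1) by (auto simp: HL_bullet_def HL_def)
qed

section \<open>The estimates near 0 and on all of \<open>\<Omega>\<close>\<close>

theorem theorem1p4:
  fixes \<Omega> :: "complex set" and p q :: "complex \<Rightarrow> complex" and \<tau> :: real and b :: complex
  assumes "open \<Omega>" and "simply_connected \<Omega>"
    and "0 \<notin> \<Omega>" and "0 \<in> closure \<Omega>" and "star_shaped_0 \<Omega>"
    and "p holomorphic_on \<Omega>" and "q holomorphic_on \<Omega>"
    and "holomorphic2_on (k0 p q) (\<Omega> \<times> \<Omega>)"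
    and "\<tau> > 0"
    and "\<exists>U. open U \<and> 0 \<in> U \<and>
           bounded ((\<lambda>a. k0 p q (a, a) - of_real \<tau> / a) ` (U \<inter> \<Omega>))"
    and "\<forall>\<sigma>>\<tau>. \<exists>U. open U \<and> (0, 0) \<in> U \<and>
           (\<forall>(a, a') \<in> U \<inter> (\<Omega> \<times> \<Omega>). cmod (k0 p q (a, a')) < \<sigma> / cmod a)"
    and "b \<in> \<Omega>"
  shows "(\<exists>U. open U \<and> 0 \<in> U \<and>
            (\<exists>C::real. \<forall>a \<in> U \<inter> \<Omega>. cmod (f0 \<Omega> p q b a) \<le> C * cmod a powr (\<tau> - 1))) \<and>
         ((\<exists>\<mu> M :: real. \<forall>a\<in>\<Omega>. \<forall>a'\<in>\<Omega>.
             cmod (k0 p q (a, a')) \<le> M / cmod a * exp (\<mu> * cmod (a - a'))) \<longrightarrow>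
          f0 \<Omega> p q b \<in> HL_bullet (\<tau> - 1) \<Omega>)"
proof -
  note op = assms(1) and sc = assms(2) and star = assms(5)
  have conn: "connected \<Omega>" using sc by (rule simply_connected_imp_connected)
  obtain U B where U: "open U" "0 \<in> U" and B: "B > 0"
    "\<And>a. a \<in> U \<inter> \<Omega> \<Longrightarrow> cmod (k0 p q (a, a) - of_real \<tau> / a) \<le> B"
    using assms(10) by (auto simp: bounded_pos)
  obtain V where V: "open V" "(0, 0) \<in> V"
    "\<And>a a'. (a, a') \<in> V \<Longrightarrow> a \<in> \<Omega> \<Longrightarrow> a' \<in> \<Omega> \<Longrightarrow> cmod (k0 p q (a, a')) < (\<tau> + 1) / cmod a"
    using assms(11)[rule_format, of "\<tau> + 1"] by fastforce
  obtain V1 V2 where V12: "open V1" "open V2" "0 \<in> V1" "0 \<in> V2" "V1 \<times> V2 \<subseteq> V"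
    using V(1,2) by (auto elim!: open_prod_elim)
  have "open (U \<inter> V1 \<inter> V2)" "0 \<in> U \<inter> V1 \<inter> V2" using U V12 by auto
  then obtain r where r: "r > 0" "ball 0 r \<subseteq> U \<inter> V1 \<inter> V2" by (rule openE)
  \<comment> \<open>The point \<open>c\<close> serves as the fixed second argument of the kernel.
    Being below \<open>r\<close> puts \<open>(a, c)\<close> in \<open>V\<close> for small
    \<open>a\<close>; being below \<open>\<tau> / B\<close> makes the singular part at
    \<open>c\<close> exceed \<open>B\<close>, whence \<open>k0 p q (c, c)\<close> and thus
    \<open>q c\<close> are nonzero.\<close>
  obtain c where c: "c \<in> \<Omega>" "cmod c < min r (\<tau> / B)"
    using assms(4)[unfolded closure_approachable, rule_format, of "min r (\<tau> / B)"] r B assms(9)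
    by (auto simp: dist_norm)
  have c0: "c \<noteq> 0" using c assms(3) by auto
  have k0c: "k0 p q (c, c) \<noteq> 0"
  proof
    assume "k0 p q (c, c) = 0"
    moreover have "c \<in> U \<inter> \<Omega>" using c r by auto
    ultimately have "\<tau> / cmod c \<le> B"
      using B(2)[of c] assms(9) by (simp add: norm_divide)
    then show False using c c0 B by (simp add: field_simps)
  qed
  then have pq: "p c \<noteq> 0" "q c \<noteq> 0" by (auto simp: k0_def)
  have "continuous_on \<Omega> (\<lambda>a. k0 p q (a, c))"
    by (rule continuous_on_compose2[OF holomorphic2_on_imp_continuous_on[OF assms(8)]])
      (use c in \<open>auto intro!: continuous_intros\<close>)
  then have "continuous_on \<Omega> (\<lambda>a. - q c / p a)" by (simp add: k0_def)
  then have p: "p a \<noteq> 0" if "a \<in> \<Omega>" for a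
    using nonzero_if_continuous_divide[OF conn holomorphic_on_imp_continuous_on[OF assms(6)]]
      pq c that by (metis neg_equal_0_iff_equal)
  \<comment> \<open>As \<open>q c\<close> is a nonzero constant, bounds of the kernel on this slice
    become bounds of \<open>1 / p\<close>.\<close>
  have inv_p: "1 / cmod (p a) = cmod (k0 p q (a, c)) / cmod (q c)" for a
    using pq by (simp add: k0_def norm_divide)
  obtain G where hol: "f0 \<Omega> p q b holomorphic_on \<Omega>"
    and G: "\<And>s. s \<in> \<Omega> \<Longrightarrow> (G has_field_derivative (k0 p q (s, s) - of_real \<tau> / s)) (at s)"
    and f0: "\<And>a. a \<in> \<Omega> \<Longrightarrow>
      cmod (f0 \<Omega> p q b a) = (cmod a / cmod b) powr \<tau> * cmod (exp (G a - G b)) / cmod (p a)"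
    using f0_exp_primitive[OF op sc assms(3,6,7) p assms(12), of \<tau>] by blast
  have b0: "b \<noteq> 0" and nz: "\<And>a. a \<in> \<Omega> \<Longrightarrow> a \<noteq> 0" using assms(3,12) by auto
  have near: "cmod (k0 p q (s, s) - of_real \<tau> / s) \<le> B" if "s \<in> \<Omega>" "cmod s < r" for s
    using B(2)[of s] that r by auto
  show ?thesis
  proof (intro conjI impI)
    have near_bound: "cmod (f0 \<Omega> p q b a) \<le> exp (B * (r + cmod c) + cmod (G c - G b)) * ((\<tau> + 1) / cmod (q c))
        / cmod b powr \<tau> * cmod a powr (\<tau> - 1)" if a: "a \<in> ball 0 r \<inter> \<Omega>" for a
    proof (rule f0_norm_le[OF f0[of a] nz[of a] b0])
      show "a \<in> \<Omega>" "a \<in> \<Omega>" using a by auto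
      have "cmod (G a - G c) \<le> B * (cmod a + cmod c)"
        using a c by (intro star_primitive_diff_le[OF op conn star G near]) auto
      also have "\<dots> \<le> B * (r + cmod c)" using a B by (intro mult_left_mono) auto
      finally show "cmod (G a - G b) \<le> B * (r + cmod c) + cmod (G c - G b)"
        using norm_diff_triangle_ineq[of "G a" "G c" "G c" "G b"] by simp
      have "a \<in> V1" "c \<in> V2" using a c r by auto
      then have "cmod (k0 p q (a, c)) \<le> (\<tau> + 1) / cmod a"
        using V(3)[of a c] V12 a c by (auto intro: less_imp_le)
      then have "cmod (k0 p q (a, c)) / cmod (q c) \<le> (\<tau> + 1) / cmod a / cmod (q c)"
        by (intro divide_right_mono) auto
      then show "1 / cmod (p a) \<le> (\<tau> + 1) / cmod (q c) / cmod a"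
        by (simp add: inv_p mult.commute)
    qed
    show "\<exists>U. open U \<and> 0 \<in> U \<and>
        (\<exists>C::real. \<forall>a \<in> U \<inter> \<Omega>. cmod (f0 \<Omega> p q b a) \<le> C * cmod a powr (\<tau> - 1))"
      by (intro exI[of _ "ball 0 r"] conjI exI ballI) (rule near_bound | simp add: r(1))+
  next
    assume "\<exists>\<mu> M :: real. \<forall>a\<in>\<Omega>. \<forall>a'\<in>\<Omega>.
        cmod (k0 p q (a, a')) \<le> M / cmod a * exp (\<mu> * cmod (a - a'))"
    then obtain \<mu> M where M: "\<And>a a'. a \<in> \<Omega> \<Longrightarrow> a' \<in> \<Omega> \<Longrightarrow>
        cmod (k0 p q (a, a')) \<le> M / cmod a * exp (\<mu> * cmod (a - a'))" by blast
    have "0 \<le> M / cmod c" using order_trans[OF norm_ge_zero M[OF c(1) c(1)]] by simp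
    then have M0: "M \<ge> 0" using c0 by (simp add: zero_le_divide_iff)
    \<comment> \<open>Outside the ball of radius \<open>r\<close> the kernel and
      \<open>\<tau> / s\<close> are estimated separately; on the diagonal the exponential factor is
      1.\<close>
    define D where "D = max B ((M + \<tau>) / r)"
    have glob: "cmod (k0 p q (s, s) - of_real \<tau> / s) \<le> D" if s: "s \<in> \<Omega>" for s
    proof (cases "cmod s < r")
      case True
      then show ?thesis using near[OF s] by (simp add: D_def)
    next
      case False
      have "cmod (k0 p q (s, s) - of_real \<tau> / s) \<le> cmod (k0 p q (s, s)) + cmod (of_real \<tau> / s)"
        by (rule norm_triangle_ineq4)
      also have "\<dots> \<le> (M + \<tau>) / cmod s"
        using M[OF s s] assms(9) by (simp add: norm_divide add_divide_distrib)
      also have "\<dots> \<le> (M + \<tau>) / r" using False r(1) M0 assms(9) nz[OF s] by (intro divide_left_mono) auto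
      finally show ?thesis by (simp add: D_def)
    qed
    show "f0 \<Omega> p q b \<in> HL_bullet (\<tau> - 1) \<Omega>"
    proof (rule in_HL_bullet_if_bound[OF hol assms(3)])
      fix a assume a: "a \<in> \<Omega>"
      let ?K = "M / cmod (q c) * exp (\<bar>\<mu>\<bar> * (cmod a + cmod c))"
      have "cmod (f0 \<Omega> p q b a) \<le> exp (D * (cmod a + cmod b)) * ?K / cmod b powr \<tau> * cmod a powr (\<tau> - 1)"
      proof (rule f0_norm_le[OF f0[OF a] nz[OF a] b0])
        \<comment> \<open>The bound \<open>D\<close> holds on all of \<open>\<Omega>\<close>, so any
          radius exceeding both moduli can be taken.\<close>
        show "cmod (G a - G b) \<le> D * (cmod a + cmod b)"
          by (rule star_primitive_diff_le[OF op conn star G glob a _ assms(12), of "cmod a + cmod b + 1"])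
            (auto intro: add_nonneg_pos)
        \<comment> \<open>The absolute value covers negative \<open>\<mu>\<close>, for which
          replacing the distance by a larger number would not give an upper bound.\<close>
        have "\<mu> * cmod (a - c) \<le> \<bar>\<mu>\<bar> * (cmod a + cmod c)"
          by (intro mult_mono norm_triangle_ineq4) auto
        then have "M / cmod a * exp (\<mu> * cmod (a - c)) \<le> M / cmod a * exp (\<bar>\<mu>\<bar> * (cmod a + cmod c))"
          using M0 by (intro mult_left_mono) auto
        with M[OF a c(1)] have "cmod (k0 p q (a, c)) \<le> M / cmod a * exp (\<bar>\<mu>\<bar> * (cmod a + cmod c))"
          by linarith
        then have "cmod (k0 p q (a, c)) / cmod (q c)
            \<le> M / cmod a * exp (\<bar>\<mu>\<bar> * (cmod a + cmod c)) / cmod (q c)"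
          by (intro divide_right_mono) auto
        then show "1 / cmod (p a) \<le> ?K / cmod a"
          by (simp add: inv_p mult_ac)
      qed
      \<comment> \<open>Collecting the factors exponential in \<open>cmod a\<close> yields the
        growth rate \<open>D + \<bar>\<mu>\<bar>\<close>; the remaining factors depend only on
        \<open>b\<close> and \<open>c\<close>.\<close>
      then show "cmod (f0 \<Omega> p q b a) \<le> exp (D * cmod b) * (M / cmod (q c) * exp (\<bar>\<mu>\<bar> * cmod c)) / cmod b powr \<tau>
          * exp ((D + \<bar>\<mu>\<bar>) * cmod a) * cmod a powr (\<tau> - 1)"
        by (simp add: distrib_left distrib_right exp_add mult_ac)
    qed
  qed
qed

end
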